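(* Let $\alpha\in\mathbb Z\setminus\{-1,0\}$ and let $(h_n)$ be the sequence with $h_0=0$, $h_1=1$, $h_2=-\alpha(\alpha+1)$, $h_3=-\alpha^3(\alpha+1)^3$, $h_4=\alpha^6(\alpha+1)^5$, and for $m\ge2$: $h_{2m+1}=h_{m+2}h_m^3-h_{m-1}h_{m+1}^3$, for $m\ge 3$: $h_{2m}=h_m\big(h_{m+2}h_{m-1}^2-h_{m-2}h_{m+1}^2\big)/h_2$. (i) If $n\equiv 4,8\pmod{12}$, then $h_n$ is a square if and only if $\alpha+1$ is a square. (ii) If $n\equiv 4,14\pmod{18}$, then $h_n$ is a cube if and only if $\alpha+1$ is a cube. (iii) If $n\equiv 8,10\pmod{18}$, then $h_n$ is a cube if and only if $\alpha$ is a cube.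
   Context: The sequence defined is the elliptic divisibility sequence attached to the point $(0,0)$ of order $6$ on the Tate normal form curve with $b=\alpha+\alpha^2$, $c=\alpha$. Convention: an integer $m$ is called a square if $m=\pm\beta^2$ for some nonzero integer $\beta$, and a cube if $m=\beta^3$ for some nonzero integer $\beta$. *)

theory Defs
  imports Complex_Main "HOL-Number_Theory.Cong"
begin

text \<open>The convention for squares admits a sign, and both notions exclude zero.\<close>

definition is_square_int :: "int \<Rightarrow> bool" where
  "is_square_int m \<longleftrightarrow> (\<exists>\<beta>::int. \<beta> \<noteq> 0 \<and> (m = \<beta> ^ 2 \<or> m = - (\<beta> ^ 2)))"

definition is_cube_int :: "int \<Rightarrow> bool" where
  "is_cube_int m \<longleftrightarrow> (\<exists>\<beta>::int. \<beta> \<noteq> 0 \<and> m = \<beta> ^ 3)"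


text \<open>
  An integer sequence with the given initial values and recurrences exists, that is, the division
  by the second term is always exact. The witness is given in closed form: for \<open>n = 6 k + r\<close>
  with \<open>r < 6\<close>, the term is a sign times a power of \<open>a\<close> times a power of \<open>a + 1\<close>.
\<close>

definition eds6_init :: "int \<Rightarrow> nat \<Rightarrow> int" where
 "eds6_init a n = [0, 1, - (a * (a + 1)), - (a ^ 3 * (a + 1) ^ 3), a ^ 6 * (a + 1) ^ 5, a ^ 10 * (a + 1) ^ 8] ! n"

definition eds6_p :: "int \<Rightarrow> nat \<Rightarrow> int" where "eds6_p a k = (- (a ^ 5 * (a + 1) ^ 4)) ^ k"
definition eds6_q :: "int \<Rightarrow> nat \<Rightarrow> int" where "eds6_q a k = (a ^ 15 * (a + 1) ^ 12) ^ (k ^ 2)"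

definition eds6 :: "int \<Rightarrow> nat \<Rightarrow> int" where
  "eds6 a n = eds6_q a (n div 6) * eds6_p a (n div 6) ^ (n mod 6) * eds6_init a (n mod 6)"

lemma eds6_p_add: "eds6_p a (k + j) = eds6_p a k * eds6_p a j"
  by (simp add: eds6_p_def power_add)

lemma eds6_q_add: "eds6_q a (k + j) = eds6_q a k * eds6_p a k ^ (6 * j) * eds6_q a j"
proof -
  have "eds6_p a k ^ (6 * j) = ((- (a ^ 5 * (a + 1) ^ 4)) ^ 6) ^ (k * j)"
    by (simp only: eds6_p_def power_mult[symmetric] ac_simps)
  also have "(- (a ^ 5 * (a + 1) ^ 4)) ^ 6 = (a ^ 15 * (a + 1) ^ 12) ^ 2"
    by (simp add: power_mult_distrib power_mult[symmetric])
  finally have "eds6_p a k ^ (6 * j) = (a ^ 15 * (a + 1) ^ 12) ^ (2 * k * j)"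
    by (simp only: power_mult[symmetric] mult.assoc)
  then show ?thesis
    by (simp only: eds6_q_def power2_sum power_add ac_simps)
qed

lemma eds6_shift: "eds6 a (6 * k + r) = eds6_q a k * eds6_p a k ^ r * eds6 a r"
proof -
  have "eds6_p a k ^ r = eds6_p a k ^ (6 * (r div 6)) * eds6_p a k ^ (r mod 6)"
    by (simp flip: power_add)
  moreover have "(6 * k + r) div 6 = k + r div 6" "(6 * k + r) mod 6 = r mod 6" by simp_all
  ultimately show ?thesis
    by (simp only: eds6_def eds6_q_add eds6_p_add power_mult_distrib ac_simps)
qed

lemma eds6_p_double: "eds6_p a (2 * k) = eds6_p a k ^ 2"
  by (simp only: mult_2 eds6_p_add power2_eq_square)

lemma eds6_q_double: "eds6_q a (2 * k) = eds6_q a k ^ 4"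
  by (simp add: eds6_q_def power_mult_distrib power_mult[symmetric] mult.commute)

lemma residue_2_7:
  assumes "m \<ge> 2"
  obtains k r where "m = 6 * k + r" "r \<in> {2,3,4,5,6,7::nat}"
proof
  show "m = 6 * ((m - 2) div 6) + ((m - 2) mod 6 + 2)" using assms by simp
  have "x < 6 \<Longrightarrow> x + 2 \<in> {2,3,4,5,6,7}" for x :: nat by auto
  then show "(m - 2) mod 6 + 2 \<in> {2,3,4,5,6,7}" by simp
qed

lemma eds6_values:
  "eds6 a 0 = 0" "eds6 a 1 = 1" "eds6 a (Suc 0) = 1"
  "eds6 a 2 = - (a * (a + 1))" "eds6 a 3 = - (a ^ 3 * (a + 1) ^ 3)"
  "eds6 a 4 = a ^ 6 * (a + 1) ^ 5" "eds6 a 5 = a ^ 10 * (a + 1) ^ 8" "eds6 a 6 = 0"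
  "eds6 a 7 = - (a ^ 20 * (a + 1) ^ 16)" "eds6 a 8 = - (a ^ 26 * (a + 1) ^ 21)"
  "eds6 a 9 = a ^ 33 * (a + 1) ^ 27" "eds6 a 10 = a ^ 41 * (a + 1) ^ 33"
  "eds6 a 11 = - (a ^ 50 * (a + 1) ^ 40)" "eds6 a 12 = 0"
  "eds6 a 13 = a ^ 70 * (a + 1) ^ 56" "eds6 a 14 = - (a ^ 81 * (a + 1) ^ 65)"
  "eds6 a 15 = - (a ^ 93 * (a + 1) ^ 75)"
proof -
  define b where "b = a + 1"
  show "eds6 a 0 = 0" "eds6 a 1 = 1" "eds6 a (Suc 0) = 1"
  "eds6 a 2 = - (a * (a + 1))" "eds6 a 3 = - (a ^ 3 * (a + 1) ^ 3)"
  "eds6 a 4 = a ^ 6 * (a + 1) ^ 5" "eds6 a 5 = a ^ 10 * (a + 1) ^ 8" "eds6 a 6 = 0"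
  "eds6 a 7 = - (a ^ 20 * (a + 1) ^ 16)" "eds6 a 8 = - (a ^ 26 * (a + 1) ^ 21)"
  "eds6 a 9 = a ^ 33 * (a + 1) ^ 27" "eds6 a 10 = a ^ 41 * (a + 1) ^ 33"
  "eds6 a 11 = - (a ^ 50 * (a + 1) ^ 40)" "eds6 a 12 = 0"
  "eds6 a 13 = a ^ 70 * (a + 1) ^ 56" "eds6 a 14 = - (a ^ 81 * (a + 1) ^ 65)"
  "eds6 a 15 = - (a ^ 93 * (a + 1) ^ 75)"
    unfolding eds6_def eds6_init_def eds6_p_def eds6_q_def b_def[symmetric]
    by (simp_all add: power_mult_distrib flip: power_mult)
      (simp_all add: numeral_eq_Suc)
qed

lemma eds6_odd_base:
  assumes "r \<in> {2,3,4,5,6,7::nat}"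
  shows "eds6 a (2 * r + 1) = eds6 a (r + 2) * eds6 a r ^ 3 - eds6 a (r - 1) * eds6 a (r + 1) ^ 3"
proof -
  define b where "b = a + 1"
  have 1: "a ^ 10 * b ^ 8 = a ^ 9 * b ^ 9 - a ^ 9 * b ^ 8"
    by (simp add: b_def algebra_simps numeral_eq_Suc)
  have "a ^ 20 * b ^ 16 = a ^ 19 * b ^ 16 * (b - 1)"
    by (simp add: b_def) (simp add: numeral_eq_Suc)
  then have 2: "a ^ 20 * b ^ 16 = a ^ 19 * b ^ 17 - a ^ 19 * b ^ 16"
    by (simp add: right_diff_distrib flip: power_Suc2)
  note v = eds6_values[of a, folded b_def]
  consider "r = 2" | "r = 3" | "r = 4" | "r = 5" | "r = 6" | "r = 7" using assms by auto
  then show ?thesis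
  proof cases
    case 1 then show ?thesis by (simp add: v \<open>a ^ 10 * b ^ 8 = _\<close>) (simp add: numeral_eq_Suc)
  next
    case 2 then show ?thesis by (simp add: v \<open>a ^ 20 * b ^ 16 = a ^ 19 * b ^ 17 - _\<close>) (simp add: numeral_eq_Suc)
  qed (simp add: v; simp add: numeral_eq_Suc)+
qed

lemma eds6_even_base:
  assumes "r \<in> {2,3,4,5,6,7::nat}"
  shows "eds6 a (2 * r) * eds6 a 2 =
    eds6 a r * (eds6 a (r + 2) * eds6 a (r - 1) ^ 2 - eds6 a (r - 2) * eds6 a (r + 1) ^ 2)"
proof -
  define b where "b = a + 1"
  note v = eds6_values[of a, folded b_def]
  consider "r = 2" | "r = 3" | "r = 4" | "r = 5" | "r = 6" | "r = 7" using assms by auto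
  then show ?thesis
    by cases (simp_all add: v, simp_all add: numeral_eq_Suc)
qed

lemma monomials_odd:
  fixes p q :: int
  shows "q ^ 4 * (p ^ 2) ^ (2 * Suc j + 1) * (x2 * x0 ^ 3 - y * x1 ^ 3) =
    (q * p ^ (Suc j + 2) * x2) * (q * p ^ Suc j * x0) ^ 3 - (q * p ^ j * y) * (q * p ^ (Suc j + 1) * x1) ^ 3"
  unfolding power_mult[symmetric] power_mult_distrib
  by (simp add: algebra_simps power_add numeral_eq_Suc)

lemma monomials_even:
  fixes p q :: int
  shows "q ^ 4 * (p ^ 2) ^ (2 * Suc (Suc j)) * (x0 * (x2 * y1 ^ 2 - y2 * x1 ^ 2)) =
    (q * p ^ Suc (Suc j) * x0) *
      ((q * p ^ (Suc (Suc j) + 2) * x2) * (q * p ^ Suc j * y1) ^ 2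
       - (q * p ^ j * y2) * (q * p ^ (Suc (Suc j) + 1) * x1) ^ 2)"
  unfolding power_mult[symmetric] power_mult_distrib
  by (simp add: algebra_simps power_add numeral_eq_Suc)

lemma eds6_odd:
  assumes "m \<ge> 2"
  shows "eds6 a (2 * m + 1) = eds6 a (m + 2) * eds6 a m ^ 3 - eds6 a (m - 1) * eds6 a (m + 1) ^ 3"
proof -
  obtain k r where m: "m = 6 * k + r" and r: "r \<in> {2,3,4,5,6,7::nat}" using residue_2_7[OF assms] .
  obtain j where j: "r = Suc j" using r by (cases r) auto
  have e: "2 * m + 1 = 6 * (2 * k) + (2 * Suc j + 1)" "m + 2 = 6 * k + (Suc j + 2)"
    "m - 1 = 6 * k + j" "m + 1 = 6 * k + (Suc j + 1)" "m = 6 * k + Suc j" using m j by auto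
  note base = eds6_odd_base[OF r, of a, unfolded j diff_Suc_1]
  have "eds6 a (2 * m + 1) = eds6_q a k ^ 4 * (eds6_p a k ^ 2) ^ (2 * Suc j + 1) * eds6 a (2 * Suc j + 1)"
    unfolding e(1) eds6_shift eds6_p_double eds6_q_double ..
  also have "\<dots> = eds6 a (6 * k + (Suc j + 2)) * eds6 a (6 * k + Suc j) ^ 3 - eds6 a (6 * k + j) * eds6 a (6 * k + (Suc j + 1)) ^ 3"
    unfolding base monomials_odd eds6_shift ..
  finally show ?thesis unfolding e(2,3,4)[symmetric] e(5)[symmetric] .
qed

lemma eds6_even:
  assumes "m \<ge> 2"
  shows "eds6 a (2 * m) * eds6 a 2 = eds6 a m * (eds6 a (m + 2) * eds6 a (m - 1) ^ 2 - eds6 a (m - 2) * eds6 a (m + 1) ^ 2)"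
proof -
  obtain k r where m: "m = 6 * k + r" and r: "r \<in> {2,3,4,5,6,7::nat}" using residue_2_7[OF assms] .
  obtain j where j: "r = Suc (Suc j)" using r by (cases r; cases "r - 1") auto
  have e: "2 * m = 6 * (2 * k) + (2 * Suc (Suc j))" "m + 2 = 6 * k + (Suc (Suc j) + 2)"
    "m - 2 = 6 * k + j" "m - 1 = 6 * k + Suc j" "m + 1 = 6 * k + (Suc (Suc j) + 1)"
    "m = 6 * k + Suc (Suc j)" using m j by auto
  have d: "Suc (Suc j) - 1 = Suc j" "Suc (Suc j) - 2 = j" by simp_all
  note base = eds6_even_base[OF r, of a, unfolded j d]
  have "eds6 a (2 * m) * eds6 a 2 =
      eds6_q a k ^ 4 * (eds6_p a k ^ 2) ^ (2 * Suc (Suc j)) * (eds6 a (2 * Suc (Suc j)) * eds6 a 2)"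
    unfolding e(1) eds6_shift eds6_p_double eds6_q_double by (simp only: mult.assoc)
  also have "\<dots> = eds6 a (6 * k + Suc (Suc j)) *
      (eds6 a (6 * k + (Suc (Suc j) + 2)) * eds6 a (6 * k + Suc j) ^ 2
       - eds6 a (6 * k + j) * eds6 a (6 * k + (Suc (Suc j) + 1)) ^ 2)"
    unfolding base monomials_even eds6_shift ..
  finally show ?thesis unfolding e(2-5)[symmetric] e(6)[symmetric] .
qed

lemma eds6_sequence_exists:
  fixes \<alpha> :: int
  assumes "\<alpha> \<notin> {-1, 0}"
  shows "\<exists>h :: nat \<Rightarrow> int.
    h 0 = 0 \<and> h 1 = 1 \<and> h 2 = - \<alpha> * (\<alpha> + 1) \<and> h 3 = - (\<alpha> ^ 3) * (\<alpha> + 1) ^ 3 \<and>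
    h 4 = \<alpha> ^ 6 * (\<alpha> + 1) ^ 5 \<and>
    (\<forall>m\<ge>2. h (2 * m + 1) = h (m + 2) * h m ^ 3 - h (m - 1) * h (m + 1) ^ 3) \<and>
    (\<forall>m\<ge>3. rat_of_int (h (2 * m)) =
      rat_of_int (h m * (h (m + 2) * h (m - 1) ^ 2 - h (m - 2) * h (m + 1) ^ 2))
      / rat_of_int (h 2))"
proof (intro exI[of _ "eds6 \<alpha>"] conjI allI impI)
  fix m :: nat
  assume "m \<ge> 3"
  then have "m \<ge> 2" by simp
  have "eds6 \<alpha> 2 \<noteq> 0" using assms by (auto simp: eds6_values)
  then show "rat_of_int (eds6 \<alpha> (2 * m)) =
      rat_of_int (eds6 \<alpha> m * (eds6 \<alpha> (m + 2) * eds6 \<alpha> (m - 1) ^ 2 - eds6 \<alpha> (m - 2) * eds6 \<alpha> (m + 1) ^ 2))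
      / rat_of_int (eds6 \<alpha> 2)"
    unfolding eds6_even[OF \<open>m \<ge> 2\<close>, symmetric] by simp
qed (simp_all only: eds6_odd, simp_all add: eds6_values)

end

theory Submission
  imports Defs
begin

text \<open>
  The recurrences determine the sequence, so \<open>h\<close> is the closed form \<open>eds6\<close>. There, shifting the
  index by \<open>12\<close> multiplies a term by a nonzero square and shifting it by \<open>18\<close> multiplies it by a
  nonzero cube, so only the residues \<open>4, 8\<close> and \<open>4, 8, 10, 14\<close> matter. Their terms are monomials
  in \<open>\<alpha>\<close> and \<open>\<alpha> + 1\<close>, and reducing the exponents modulo \<open>2\<close> or \<open>3\<close> leaves \<open>\<plusminus>(\<alpha> + 1)\<close>,
  respectively \<open>\<plusminus>(\<alpha> + 1)\<^sup>2\<close> or \<open>\<plusminus>\<alpha>\<^sup>2\<close>.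
\<close>

lemma is_square_int_minus_iff [simp]: "is_square_int (- x) \<longleftrightarrow> is_square_int x"
  unfolding is_square_int_def by (metis minus_minus)

text \<open>The converse is cancellation: \<open>c ^ 2\<close> divides \<open>b ^ 2\<close>, so
  \<open>c\<close> divides \<open>b\<close> over the integers, and the quotient is the root sought
  for \<open>x\<close>.\<close>

lemma is_square_int_square_mult_iff:
  assumes "c \<noteq> 0"
  shows "is_square_int (c ^ 2 * x) \<longleftrightarrow> is_square_int x"
proof
  assume "is_square_int x"
  then obtain b where "b \<noteq> 0" "x = b ^ 2 \<or> x = - (b ^ 2)" by (auto simp: is_square_int_def)
  then have "c * b \<noteq> 0" "c ^ 2 * x = (c * b) ^ 2 \<or> c ^ 2 * x = - ((c * b) ^ 2)"
    using assms by (auto simp: power_mult_distrib)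
  then show "is_square_int (c ^ 2 * x)" unfolding is_square_int_def by blast
next
  assume "is_square_int (c ^ 2 * x)"
  then obtain b where b: "b \<noteq> 0" "c ^ 2 * x = b ^ 2 \<or> c ^ 2 * x = - (b ^ 2)"
    by (auto simp: is_square_int_def)
  then have "c ^ 2 dvd b ^ 2" by (metis dvd_triv_left dvd_minus_iff)
  then obtain d where d: "b = c * d" by (auto simp: pow_divides_pow_iff elim: dvdE)
  have "c ^ 2 * x = c ^ 2 * d ^ 2 \<or> c ^ 2 * x = c ^ 2 * - (d ^ 2)"
    using b d by (simp add: power_mult_distrib)
  then have "x = d ^ 2 \<or> x = - (d ^ 2)" using assms by (metis mult_cancel_left power_not_zero)
  moreover have "d \<noteq> 0" using b d by auto
  ultimately show "is_square_int x" unfolding is_square_int_def by blast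
qed

lemma is_cube_int_cube_mult_iff:
  assumes "c \<noteq> 0"
  shows "is_cube_int (c ^ 3 * x) \<longleftrightarrow> is_cube_int x"
proof
  assume "is_cube_int x"
  then obtain b where "b \<noteq> 0" "x = b ^ 3" by (auto simp: is_cube_int_def)
  then have "c * b \<noteq> 0" "c ^ 3 * x = (c * b) ^ 3"
    using assms by (auto simp: power_mult_distrib)
  then show "is_cube_int (c ^ 3 * x)" unfolding is_cube_int_def by blast
next
  assume "is_cube_int (c ^ 3 * x)"
  then obtain b where b: "b \<noteq> 0" "c ^ 3 * x = b ^ 3" by (auto simp: is_cube_int_def)
  then have "c ^ 3 dvd b ^ 3" by (metis dvd_triv_left)
  then obtain d where d: "b = c * d" by (auto simp: pow_divides_pow_iff elim: dvdE)
  then have "x = d ^ 3" "d \<noteq> 0" using assms b by (auto simp: power_mult_distrib)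
  then show "is_cube_int x" unfolding is_cube_int_def by blast
qed

text \<open>The sign is a cube factor, since (-1)^3 = -1.\<close>

lemma is_cube_int_minus_iff [simp]: "is_cube_int (- x) \<longleftrightarrow> is_cube_int x"
  using is_cube_int_cube_mult_iff[of "-1" x] by simp

text \<open>If \<open>x ^ 2 = b ^ 3\<close>, squaring gives \<open>x ^ 3 * x = (b ^ 2) ^ 3\<close>,
  and the factor \<open>x ^ 3\<close> cancels.\<close>

lemma is_cube_int_power2_iff:
  assumes "x \<noteq> 0"
  shows "is_cube_int (x ^ 2) \<longleftrightarrow> is_cube_int x"
proof
  assume "is_cube_int x"
  then obtain b where "b \<noteq> 0" "x = b ^ 3" by (auto simp: is_cube_int_def)
  then have "b ^ 2 \<noteq> 0" "x ^ 2 = (b ^ 2) ^ 3" by (simp_all flip: power_mult)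
  then show "is_cube_int (x ^ 2)" unfolding is_cube_int_def by blast
next
  assume "is_cube_int (x ^ 2)"
  then obtain b where "b \<noteq> 0" "x ^ 2 = b ^ 3" by (auto simp: is_cube_int_def)
  moreover have "x ^ 3 * x = (x ^ 2) ^ 2" by (simp add: numeral_eq_Suc)
  ultimately have "b ^ 2 \<noteq> 0" "x ^ 3 * x = (b ^ 2) ^ 3" by (simp_all flip: power_mult)
  then have "is_cube_int (x ^ 3 * x)" unfolding is_cube_int_def by blast
  then show "is_cube_int x" using is_cube_int_cube_mult_iff assms by blast
qed

text \<open>Strong induction works because the largest index on the right, \<open>m + 2\<close>,
  lies below \<open>2 * m + 1\<close> for m \<ge> 2 and below \<open>2 * m\<close> for m \<ge> 3.
  The even recurrence is multiplied out so that everything stays in the integers.\<close>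

lemma eds6_unique:
  fixes \<alpha> :: int and h :: "nat \<Rightarrow> int"
  assumes "\<alpha> \<notin> {-1, 0}"
    and init: "h 0 = 0" "h 1 = 1" "h 2 = eds6 \<alpha> 2" "h 3 = eds6 \<alpha> 3" "h 4 = eds6 \<alpha> 4"
    and odd: "\<And>m. m \<ge> 2 \<Longrightarrow> h (2 * m + 1) = h (m + 2) * h m ^ 3 - h (m - 1) * h (m + 1) ^ 3"
    and even: "\<And>m. m \<ge> 3 \<Longrightarrow>
      h (2 * m) * h 2 = h m * (h (m + 2) * h (m - 1) ^ 2 - h (m - 2) * h (m + 1) ^ 2)"
  shows "h n = eds6 \<alpha> n"
proof (induction n rule: less_induct)
  case (less n)
  \<comment> \<open>Index 4 counts as initial: at m = 2 the even recurrence would refer to itself,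
    as \<open>m + 2 = 2 * m\<close>.\<close>
  consider "n \<in> {0, 1, 2, 3, 4}" | m where "n = 2 * m + 1" "m \<ge> 2" | m where "n = 2 * m" "m \<ge> 3"
  proof (cases "n < 5")
    case True
    then have "n \<in> {0, 1, 2, 3, 4}" by auto
    then show ?thesis using that by blast
  next
    case False
    then show ?thesis using that(2)[of "n div 2"] that(3)[of "n div 2"]
      by (cases "even n") (auto elim!: evenE oddE)
  qed
  then show ?case
  proof cases
    case 1
    then show ?thesis using init eds6_values(1,2) by auto
  next
    case (2 m)
    then have "h (m + 2) = eds6 \<alpha> (m + 2)" "h m = eds6 \<alpha> m" "h (m - 1) = eds6 \<alpha> (m - 1)"
      "h (m + 1) = eds6 \<alpha> (m + 1)" by (simp_all add: less.IH)
    then show ?thesis using odd[of m] eds6_odd[of m \<alpha>] 2 by simp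
  next
    case (3 m)
    then have "h (m + 2) = eds6 \<alpha> (m + 2)" "h m = eds6 \<alpha> m" "h (m - 1) = eds6 \<alpha> (m - 1)"
      "h (m - 2) = eds6 \<alpha> (m - 2)" "h (m + 1) = eds6 \<alpha> (m + 1)" by (simp_all add: less.IH)
    then have "h n * eds6 \<alpha> 2 = eds6 \<alpha> n * eds6 \<alpha> 2"
      using even[of m] eds6_even[of m \<alpha>] 3 init by simp
    moreover have "eds6 \<alpha> 2 \<noteq> 0" using assms(1) by (auto simp: eds6_values)
    ultimately show ?thesis by simp
  qed
qed

text \<open>A shift by 12 is a shift by 6 blocks with \<open>2 * k\<close> in place of
  \<open>k\<close>, which turns the \<open>eds6_q\<close> factor into a fourth power and the
  \<open>eds6_p\<close> factor into a square.\<close>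

lemma is_square_int_eds6_shift:
  assumes "a \<notin> {-1, 0}"
  shows "is_square_int (eds6 a (12 * k + r)) \<longleftrightarrow> is_square_int (eds6 a r)"
proof -
  have "eds6 a (12 * k + r) = (eds6_q a k ^ 2 * eds6_p a k ^ r) ^ 2 * eds6 a r"
    using eds6_shift[of a "2 * k" r]
    by (simp add: eds6_p_double eds6_q_double power_mult_distrib) (simp add: mult.commute flip: power_mult)
  moreover have "eds6_q a k ^ 2 * eds6_p a k ^ r \<noteq> 0"
    using assms by (auto simp: eds6_q_def eds6_p_def)
  ultimately show ?thesis by (simp add: is_square_int_square_mult_iff)
qed

lemma is_cube_int_eds6_shift:
  assumes "a \<notin> {-1, 0}"
  shows "is_cube_int (eds6 a (18 * k + r)) \<longleftrightarrow> is_cube_int (eds6 a r)"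
proof -
  \<comment> \<open>The cube root of the shift factor: the base of \<open>eds6_q\<close> is already
    a cube, and replacing \<open>k\<close> by \<open>3 * k\<close> cubes the \<open>eds6_p\<close>
    factor.\<close>
  define c where "c = (a ^ 5 * (a + 1) ^ 4) ^ ((3 * k) ^ 2) * eds6_p a k ^ r"
  have "a ^ 15 * (a + 1) ^ 12 = (a ^ 5 * (a + 1) ^ 4) ^ 3"
    by (simp add: power_mult_distrib flip: power_mult)
  then have "eds6_q a (3 * k) = ((a ^ 5 * (a + 1) ^ 4) ^ ((3 * k) ^ 2)) ^ 3"
    by (simp only: eds6_q_def power_mult[symmetric] mult.commute)
  moreover have "eds6_p a (3 * k) ^ r = (eds6_p a k ^ r) ^ 3"
    by (simp only: eds6_p_def power_mult[symmetric] ac_simps)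
  ultimately have "eds6 a (18 * k + r) = c ^ 3 * eds6 a r"
    using eds6_shift[of a "3 * k" r] by (simp add: c_def power_mult_distrib)
  moreover have "c \<noteq> 0" using assms by (auto simp: c_def eds6_p_def)
  ultimately show ?thesis by (simp add: is_cube_int_cube_mult_iff)
qed

text \<open>At both indices \<open>a\<close> has an even exponent and \<open>a + 1\<close> an odd
  one; the sign at index 8 is absorbed by the convention for squares.\<close>

lemma is_square_int_eds6_iff:
  assumes "a \<notin> {-1, 0}" and "r \<in> {4, 8}"
  shows "is_square_int (eds6 a r) \<longleftrightarrow> is_square_int (a + 1)"
proof -
  define b where "b = a + 1"
  have "a \<noteq> 0" "b \<noteq> 0" using assms by (auto simp: b_def)
  then have nz: "a ^ i * b ^ j \<noteq> 0" for i j by simp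
  have "a ^ 6 * b ^ 5 = (a ^ 3 * b ^ 2) ^ 2 * b" "a ^ 26 * b ^ 21 = (a ^ 13 * b ^ 10) ^ 2 * b"
    by (simp_all add: power_mult_distrib flip: power_mult power_Suc2)
  then show ?thesis
    using assms(2) is_square_int_square_mult_iff[OF nz]
    by (auto simp: eds6_values simp flip: b_def)
qed

text \<open>Modulo 3 the exponents of \<open>a\<close> and \<open>a + 1\<close> are (0, 2) at
  indices 4 and 14, and (2, 0) at 8 and 10. The square left over is a cube exactly when its root
  is.\<close>

lemma is_cube_int_eds6_iff:
  assumes "a \<notin> {-1, 0}"
  shows "r \<in> {4, 14} \<Longrightarrow> is_cube_int (eds6 a r) \<longleftrightarrow> is_cube_int (a + 1)"
    and "r \<in> {8, 10} \<Longrightarrow> is_cube_int (eds6 a r) \<longleftrightarrow> is_cube_int a"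
proof -
  define b where "b = a + 1"
  have ab: "a \<noteq> 0" "b \<noteq> 0" using assms by (auto simp: b_def)
  then have nz: "a ^ i * b ^ j \<noteq> 0" for i j by simp
  have "a ^ 6 * b ^ 5 = (a ^ 2 * b ^ 1) ^ 3 * b ^ 2"
    "a ^ 81 * b ^ 65 = (a ^ 27 * b ^ 21) ^ 3 * b ^ 2"
    by (simp_all add: power_mult_distrib flip: power_mult power_add)
  \<comment> \<open>The instance with exponents 2 and 1 is listed separately because
    \<open>b ^ 1\<close> simplifies to \<open>b\<close>, which the pattern \<open>b ^ j\<close> does
    not match.\<close>
  then show "r \<in> {4, 14} \<Longrightarrow> is_cube_int (eds6 a r) \<longleftrightarrow> is_cube_int (a + 1)"
    using is_cube_int_cube_mult_iff[OF nz] is_cube_int_cube_mult_iff[OF nz[of 2 1]]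
      is_cube_int_power2_iff[OF ab(2)]
    by (auto simp: eds6_values simp flip: b_def)
  have "a ^ 26 * b ^ 21 = (a ^ 8 * b ^ 7) ^ 3 * a ^ 2"
    "a ^ 41 * b ^ 33 = (a ^ 13 * b ^ 11) ^ 3 * a ^ 2"
    by (simp_all add: power_mult_distrib ac_simps flip: power_mult power_add)
  then show "r \<in> {8, 10} \<Longrightarrow> is_cube_int (eds6 a r) \<longleftrightarrow> is_cube_int a"
    using is_cube_int_cube_mult_iff[OF nz] is_cube_int_power2_iff[OF ab(1)]
    by (auto simp: eds6_values simp flip: b_def)
qed

theorem theorem5p6:
  fixes \<alpha> :: int and h :: "nat \<Rightarrow> int" and n :: nat
  assumes "\<alpha> \<notin> {-1, 0}"
    and "h 0 = 0"
    and "h 1 = 1"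
    and "h 2 = - \<alpha> * (\<alpha> + 1)"
    and "h 3 = - (\<alpha> ^ 3) * (\<alpha> + 1) ^ 3"
    and "h 4 = \<alpha> ^ 6 * (\<alpha> + 1) ^ 5"
    and "\<And>m. m \<ge> 2 \<Longrightarrow> h (2 * m + 1) = h (m + 2) * h m ^ 3 - h (m - 1) * h (m + 1) ^ 3"
    and "\<And>m. m \<ge> 3 \<Longrightarrow>
      rat_of_int (h (2 * m)) =
        rat_of_int (h m * (h (m + 2) * h (m - 1) ^ 2 - h (m - 2) * h (m + 1) ^ 2))
        / rat_of_int (h 2)"
  shows "([n = 4] (mod 12) \<or> [n = 8] (mod 12) \<longrightarrow>
            (is_square_int (h n) \<longleftrightarrow> is_square_int (\<alpha> + 1)))
       \<and> ([n = 4] (mod 18) \<or> [n = 14] (mod 18) \<longrightarrow>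
            (is_cube_int (h n) \<longleftrightarrow> is_cube_int (\<alpha> + 1)))
       \<and> ([n = 8] (mod 18) \<or> [n = 10] (mod 18) \<longrightarrow>
            (is_cube_int (h n) \<longleftrightarrow> is_cube_int \<alpha>))"
proof -
  have nz: "h 2 \<noteq> 0" using assms(1,4) by auto
  have h: "h n = eds6 \<alpha> n"
  proof (rule eds6_unique[OF assms(1)])
    fix m :: nat
    assume "m \<ge> 3"
    \<comment> \<open>Clearing the nonzero denominator \<open>h 2\<close> gives an equation of
      embedded integers, hence one of integers.\<close>
    from assms(8)[OF this] nz
    have "rat_of_int (h (2 * m) * h 2) =
        rat_of_int (h m * (h (m + 2) * h (m - 1) ^ 2 - h (m - 2) * h (m + 1) ^ 2))"
      by (simp add: field_simps)
    then show "h (2 * m) * h 2 = h m * (h (m + 2) * h (m - 1) ^ 2 - h (m - 2) * h (m + 1) ^ 2)"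
      by (simp only: of_int_eq_iff)
  qed (use assms(2-7) in \<open>simp_all add: eds6_values\<close>)
  \<comment> \<open>Division with remainder by 12, and below by 18, turns each congruence into an
    equation for the remainder.\<close>
  have sq: "is_square_int (h n) \<longleftrightarrow> is_square_int (eds6 \<alpha> (n mod 12))"
    using is_square_int_eds6_shift[OF assms(1), of "n div 12" "n mod 12"] by (simp add: h)
  have cu: "is_cube_int (h n) \<longleftrightarrow> is_cube_int (eds6 \<alpha> (n mod 18))"
    using is_cube_int_eds6_shift[OF assms(1), of "n div 18" "n mod 18"] by (simp add: h)
  show ?thesis
    unfolding sq cu
    using is_square_int_eds6_iff[OF assms(1), of "n mod 12"]
      is_cube_int_eds6_iff[OF assms(1), of "n mod 18"]
    by (simp add: cong_def)
qed

end
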